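(* Let $i\in\{0,1,2,\dots\}$, let $x_i,x_{i+1}\in(l,r]$, and let $\hat x_{i+1}\in(l,\min(x_i,x_{i+1})]$. Let $P_i$ and $P_{i+1}=f\,P_i/P_i'$ be the iterates defined in the context. (i) Suppose $P_i$ is an upper bound on $F$ on $(l,x_i)$ and $P_{i+1}$ is a lower bound on $F$ on $(l,x_{i+1})$, both in the sense of the context. Put $P_{L,i}(x)=2F(x)-P_i(x)$. If $$P_{i+1}'(x)+P_i'(x)-2f(x)\ge 0\qquad\text{for all }x\in(l,\hat x_{i+1}),$$ then $P_{i+1}$ is a tighter bound on $F$ than $P_i$ in the sense that $$P_{L,i}(x)\le P_{i+1}(x)\qquad\text{for all }x\in(l,\hat x_{i+1}).$$ (ii) Suppose $P_i$ is a lower bound on $F$ on $(l,x_i)$ and $P_{i+1}$ is an upper bound on $F$ on $(l,x_{i+1})$, both in the sense of the context. Put $P_{U,i}(x)=2F(x)-P_i(x)$. If $$P_{i+1}'(x)+P_i'(x)-2f(x)\le 0\qquad\text{for all }x\in(l,\hat x_{i+1}),$$ then $P_{i+1}$ is a tighter bound on $F$ than $P_i$ in the sense that $$P_{U,i}(x)\ge P_{i+1}(x)\qquad\text{for all }x\in(l,\hat x_{i+1}).$$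
   Context: $X$ is a continuous real random variable with cumulative distribution function $F(x)=\Pr\{X\le x\}$ and probability density function $f(x)=F'(x)$. The support of $f$ is an interval with endpoints $l$ and $r$, $-\infty\le l<r\le\infty$, each endpoint being included or not. The density $f$ is continuous on the support and its derivative $f'$ exists there; all functions are assumed differentiable as often as needed for the expressions below to make sense. Given a function $g$, the iterates are $$P_0(x)=f(x)\frac{g(x)}{g'(x)},\qquad P_{i+1}(x)=f(x)\frac{P_i(x)}{P_i'(x)},\quad i=0,1,2,\dots$$ Put $g_0=g$ and $g_j=P_{j-1}$ for $j\ge1$, so that $P_j=f\,g_j/g_j'$ for every $j\ge0$. "$P_j$ is an upper (respectively lower) bound on $F$ on $(l,a)$" means that it is obtained as such from the following criterion: $g_j$ is continuous, positive and strictly increasing on $(l,a)$ with $g_j'(x)>0$ there, $\lim_{x\to l}P_j(x)=0$, and $P_j'(x)-f(x)\ge 0$ (respectively $P_j'(x)-f(x)\le 0$) for all $x\in(l,a)$; consequently $F(x)\le P_j(x)$ (respectively $F(x)\ge P_j(x)$) for all $x\in(l,a)$. *)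

theory Defs
  imports "HOL-Probability.Probability"
begin

primrec iter_P :: "(real \<Rightarrow> real) \<Rightarrow> (real \<Rightarrow> real) \<Rightarrow> nat \<Rightarrow> real \<Rightarrow> real" where
  "iter_P f g 0 = (\<lambda>x. f x * (g x / deriv g x))"
| "iter_P f g (Suc i) = (\<lambda>x. f x * (iter_P f g i x / deriv (iter_P f g i) x))"

definition iter_g :: "(real \<Rightarrow> real) \<Rightarrow> (real \<Rightarrow> real) \<Rightarrow> nat \<Rightarrow> real \<Rightarrow> real" where
  "iter_g f g j = (case j of 0 \<Rightarrow> g | Suc k \<Rightarrow> iter_P f g k)"

(* deriv is total and x / 0 = 0, so the implicit convention that all expressions involved
   make sense has to be spelled out: P_0, ..., P_j are genuine quotients on A, and P_j
   is differentiable there. *)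
definition iterates_defined_on ::
  "(real \<Rightarrow> real) \<Rightarrow> (real \<Rightarrow> real) \<Rightarrow> nat \<Rightarrow> real set \<Rightarrow> bool" where
  "iterates_defined_on f g j A \<longleftrightarrow>
     (\<forall>k\<le>j. \<forall>x\<in>A. iter_g f g k differentiable (at x) \<and> deriv (iter_g f g k) x \<noteq> 0) \<and>
     (\<forall>x\<in>A. iter_P f g j differentiable (at x))"

(* The one-sided limit at the extended-real endpoint l is taken along at_right l in ereal,
   as in the library's interval integrals: it is at_right for finite l and at_bot for
   l = -\<infinity>. *)
definition bound_premises ::
  "(real \<Rightarrow> real) \<Rightarrow> (real \<Rightarrow> real) \<Rightarrow> nat \<Rightarrow> ereal \<Rightarrow> ereal \<Rightarrow> bool" where
  "bound_premises f g j l a \<longleftrightarrow>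
     iterates_defined_on f g j (einterval l a) \<and>
     continuous_on (einterval l a) (iter_g f g j) \<and>
     (\<forall>x\<in>einterval l a. 0 < iter_g f g j x) \<and>
     strict_mono_on (einterval l a) (iter_g f g j) \<and>
     (\<forall>x\<in>einterval l a. 0 < deriv (iter_g f g j) x) \<and>
     ((iter_P f g j \<circ> real_of_ereal) \<longlongrightarrow> 0) (at_right l)"

(* These are the premises of the criterion only; the resulting inequalities between P_j and
   the distribution function are consequences and not part of the definitions. *)
definition upper_bound_by_criterion ::
  "(real \<Rightarrow> real) \<Rightarrow> (real \<Rightarrow> real) \<Rightarrow> nat \<Rightarrow> ereal \<Rightarrow> ereal \<Rightarrow> bool" where
  "upper_bound_by_criterion f g j l a \<longleftrightarrow>
     bound_premises f g j l a \<and>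
     (\<forall>x\<in>einterval l a. deriv (iter_P f g j) x - f x \<ge> 0)"

definition lower_bound_by_criterion ::
  "(real \<Rightarrow> real) \<Rightarrow> (real \<Rightarrow> real) \<Rightarrow> nat \<Rightarrow> ereal \<Rightarrow> ereal \<Rightarrow> bool" where
  "lower_bound_by_criterion f g j l a \<longleftrightarrow>
     bound_premises f g j l a \<and>
     (\<forall>x\<in>einterval l a. deriv (iter_P f g j) x - f x \<le> 0)"

end

theory Submission
  imports Defs
begin

text \<open>
  Write \<open>H = P\<^bsub>i+1\<^esub> + P\<^bsub>i\<^esub> - 2 F\<close>. The claim of part (i) is \<open>H \<ge> 0\<close>, that of part (ii) is
  \<open>H \<le> 0\<close>. The derivative of \<open>H\<close> is the expression whose sign is assumed, so \<open>H\<close> is monotone on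
  the interval; and \<open>H\<close> tends to \<open>0\<close> at the left endpoint, because both iterates do by the
  criterion and \<open>F\<close> does since no mass lies to the left of \<open>l\<close>
  (\<open>cdf_tendsto_zero_at_lower_end\<close>). A monotone function lies on one side of its limit at the
  left end (\<open>nonneg_if_deriv_nonneg_and_limit_zero\<close>), which gives (i); (ii) is the same
  argument for \<open>- H\<close>.
\<close>

text \<open>The limit at \<open>l\<close> is a limit of values \<open>h t \<le> h x\<close>, so it bounds \<open>h x\<close> from below. Staying
  with the filter at the extended real \<open>l\<close> covers finite and infinite \<open>l\<close> together.\<close>

lemma nonneg_if_deriv_nonneg_and_limit_zero:
  fixes h h' :: "real \<Rightarrow> real" and l b :: ereal
  assumes deriv: "\<And>t. t \<in> einterval l b \<Longrightarrow> (h has_real_derivative h' t) (at t)"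
    and nonneg: "\<And>t. t \<in> einterval l b \<Longrightarrow> 0 \<le> h' t"
    and lim: "((h \<circ> real_of_ereal) \<longlongrightarrow> 0) (at_right l)"
    and x: "x \<in> einterval l b"
  shows "0 \<le> h x"
proof (rule tendsto_upperbound[OF lim])
  have lx: "l < ereal x" and xb: "ereal x < b"
    using x by (auto simp: einterval_def)
  have "h (real_of_ereal y) \<le> h x" if y: "l < y" "y < ereal x" for y
  proof -
    obtain t where t: "y = ereal t"
      using y by (cases y) auto
    have "h t \<le> h x"
    proof (rule DERIV_nonneg_imp_nondecreasing[where f = h])
      show "t \<le> x" using y t by simp
      fix s assume "t \<le> s" "s \<le> x"
      then have "l < ereal s" "ereal s < b"
        using y t xb less_le_trans[of l "ereal t" "ereal s"] le_less_trans[of "ereal s" "ereal x" b]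
        by simp_all
      then have "s \<in> einterval l b" by (simp add: einterval_def)
      then show "\<exists>d. (h has_real_derivative d) (at s) \<and> 0 \<le> d"
        using deriv nonneg by blast
    qed
    then show ?thesis by (simp add: t)
  qed
  then show "\<forall>\<^sub>F y in at_right l. (h \<circ> real_of_ereal) y \<le> h x"
    using eventually_at_right[OF lx] lx by auto
  show "at_right l \<noteq> bot"
    using eventually_at_right[OF lx, of "\<lambda>_. False"] dense[of l] by (auto simp: trivial_limit_def)
qed

text \<open>For infinite \<open>l\<close> this is the behaviour of every distribution function at \<open>-\<infinity>\<close>. For finite \<open>l\<close>
  it is right continuity together with \<open>F l = 0\<close>: the density vanishes to the left of \<open>l\<close>, and
  the point \<open>l\<close> itself, where the density may be positive, is a null set.\<close>

lemma cdf_tendsto_zero_at_lower_end: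
  fixes f :: "real \<Rightarrow> real" and l :: ereal
  assumes "prob_space M"
    and dist: "distributed M lborel X (\<lambda>x. ennreal (f x))"
    and supp: "\<And>x. f x \<noteq> 0 \<Longrightarrow> l \<le> ereal x"
    and "l \<noteq> \<infinity>"
  shows "((cdf (distr M borel X) \<circ> real_of_ereal) \<longlongrightarrow> 0) (at_right l)"
proof -
  interpret prob_space M by fact
  have X: "X \<in> borel_measurable M"
    using dist by (simp add: distributed_def)
  interpret D: real_distribution "distr M borel X"
    using X by (rule real_distribution_distr)
  show ?thesis
  proof (cases l)
    case (real a)
    have "distr M borel X = density lborel (\<lambda>x. ennreal (f x))"
      using distributed_distr_eq_density[OF dist] by (simp cong: distr_cong)
    then have "emeasure (distr M borel X) {..a} = (\<integral>\<^sup>+x. ennreal (f x) * indicator {..a} x \<partial>lborel)"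
      using distributed_borel_measurable[OF dist] by (simp add: emeasure_density)
    also have "\<dots> = (\<integral>\<^sup>+x. 0 \<partial>(lborel :: real measure))"
    proof (rule nn_integral_cong_AE)
      have "f x = 0" if "x < a" for x
        using supp[of x] that real by fastforce
      then show "AE x in lborel. ennreal (f x) * indicator {..a} x = 0"
        using AE_lborel_singleton[of a]
        by (auto elim!: eventually_mono simp: indicator_def)
    qed
    finally have "cdf (distr M borel X) a = 0"
      by (simp add: cdf_def measure_def)
    moreover have "(cdf (distr M borel X) \<longlongrightarrow> cdf (distr M borel X) a) (at_right a)"
      using D.cdf_is_right_cont by (simp add: continuous_within)
    ultimately show ?thesis
      by (simp add: real ereal_tendsto_simps)
  next
    case MInf
    then show ?thesis
      using D.cdf_lim_at_bot by (simp add: ereal_tendsto_simps)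
  qed (use \<open>l \<noteq> \<infinity>\<close> in simp)
qed

theorem lemma9:
  fixes M :: "'a measure" and X :: "'a \<Rightarrow> real"
    and F f g :: "real \<Rightarrow> real"
    and l r x\<^sub>i x\<^sub>s xhat :: ereal and i :: nat
  assumes "prob_space M"
    and "distributed M lborel X (\<lambda>x. ennreal (f x))"
    and "\<And>x. 0 \<le> f x"
    and "F = cdf (distr M borel X)"
    and "l < r"
    and "einterval l r \<subseteq> {x. f x \<noteq> 0}"
    and "{x. f x \<noteq> 0} \<subseteq> {x. l \<le> ereal x \<and> ereal x \<le> r}"
    and "continuous_on {x. f x \<noteq> 0} f"
    and "f differentiable_on {x. f x \<noteq> 0}"
    and "\<And>x. x \<in> einterval l r \<Longrightarrow> (F has_real_derivative f x) (at x)"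
    and "x\<^sub>i \<in> {l<..r}"
    and "x\<^sub>s \<in> {l<..r}"
    and "xhat \<in> {l<..min x\<^sub>i x\<^sub>s}"
  shows "(upper_bound_by_criterion f g i l x\<^sub>i \<and>
          lower_bound_by_criterion f g (Suc i) l x\<^sub>s \<and>
          (\<forall>x\<in>einterval l xhat.
             deriv (iter_P f g (Suc i)) x + deriv (iter_P f g i) x - 2 * f x \<ge> 0)
          \<longrightarrow> (\<forall>x\<in>einterval l xhat. 2 * F x - iter_P f g i x \<le> iter_P f g (Suc i) x))
       \<and> (lower_bound_by_criterion f g i l x\<^sub>i \<and>
          upper_bound_by_criterion f g (Suc i) l x\<^sub>s \<and>
          (\<forall>x\<in>einterval l xhat.
             deriv (iter_P f g (Suc i)) x + deriv (iter_P f g i) x - 2 * f x \<le> 0)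
          \<longrightarrow> (\<forall>x\<in>einterval l xhat. 2 * F x - iter_P f g i x \<ge> iter_P f g (Suc i) x))"
proof -
  let ?h = "\<lambda>x. iter_P f g (Suc i) x + iter_P f g i x - 2 * F x"
  let ?h' = "\<lambda>x. deriv (iter_P f g (Suc i)) x + deriv (iter_P f g i) x - 2 * f x"
  have sub: "einterval l xhat \<subseteq> einterval l x\<^sub>i" "einterval l xhat \<subseteq> einterval l x\<^sub>s"
    "einterval l xhat \<subseteq> einterval l r"
    using assms(11-13) by (auto simp: einterval_def intro: less_le_trans)
  have F_lim: "((F \<circ> real_of_ereal) \<longlongrightarrow> 0) (at_right l)"
    unfolding assms(4)
    using assms(5,7) by (intro cdf_tendsto_zero_at_lower_end[OF assms(1,2)]) auto
  have lim: "((?h \<circ> real_of_ereal) \<longlongrightarrow> 0) (at_right l)"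
    if "bound_premises f g i l x\<^sub>i" "bound_premises f g (Suc i) l x\<^sub>s"
  proof -
    have "((\<lambda>y. iter_P f g (Suc i) (real_of_ereal y) + iter_P f g i (real_of_ereal y)
             - 2 * F (real_of_ereal y)) \<longlongrightarrow> 0 + 0 - 2 * 0) (at_right l)"
      using that F_lim unfolding bound_premises_def comp_def
      by (intro tendsto_intros) auto
    then show ?thesis by (simp add: comp_def)
  qed
  have der: "(?h has_real_derivative ?h' x) (at x)"
    if "bound_premises f g i l x\<^sub>i" "bound_premises f g (Suc i) l x\<^sub>s" "x \<in> einterval l xhat" for x
  proof -
    have "iter_P f g i differentiable (at x)" "iter_P f g (Suc i) differentiable (at x)"
      using that sub unfolding bound_premises_def iterates_defined_on_def by blast+
    then have "(iter_P f g i has_real_derivative deriv (iter_P f g i) x) (at x)"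
      "(iter_P f g (Suc i) has_real_derivative deriv (iter_P f g (Suc i)) x) (at x)"
      by (simp_all only: DERIV_deriv_iff_real_differentiable)
    moreover have "(F has_real_derivative f x) (at x)"
      using assms(10) that sub by blast
    ultimately show ?thesis
      by (intro DERIV_diff DERIV_add DERIV_cmult)
  qed
  show ?thesis
  proof (intro conjI impI ballI)
    fix x
    assume *: "upper_bound_by_criterion f g i l x\<^sub>i \<and>
      lower_bound_by_criterion f g (Suc i) l x\<^sub>s \<and> (\<forall>x\<in>einterval l xhat. ?h' x \<ge> 0)"
      and x: "x \<in> einterval l xhat"
    then have b: "bound_premises f g i l x\<^sub>i" "bound_premises f g (Suc i) l x\<^sub>s"
      unfolding upper_bound_by_criterion_def lower_bound_by_criterion_def by blast+
    have "0 \<le> ?h x"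
      using * by (intro nonneg_if_deriv_nonneg_and_limit_zero[OF der[OF b] _ lim[OF b] x]) blast+
    then show "2 * F x - iter_P f g i x \<le> iter_P f g (Suc i) x" by linarith
  next
    fix x
    assume *: "lower_bound_by_criterion f g i l x\<^sub>i \<and>
      upper_bound_by_criterion f g (Suc i) l x\<^sub>s \<and> (\<forall>x\<in>einterval l xhat. ?h' x \<le> 0)"
      and x: "x \<in> einterval l xhat"
    then have b: "bound_premises f g i l x\<^sub>i" "bound_premises f g (Suc i) l x\<^sub>s"
      unfolding upper_bound_by_criterion_def lower_bound_by_criterion_def by blast+
    have neg_lim: "(((\<lambda>x. - ?h x) \<circ> real_of_ereal) \<longlongrightarrow> 0) (at_right l)"
      using tendsto_minus[OF lim[OF b]] by (simp only: comp_def minus_zero)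
    have "0 \<le> - ?h x"
    proof (rule nonneg_if_deriv_nonneg_and_limit_zero[OF DERIV_minus[OF der[OF b]] _ neg_lim x])
      show "0 \<le> - ?h' t" if "t \<in> einterval l xhat" for t
        using * that by (simp only: neg_0_le_iff_le)
    qed
    then show "2 * F x - iter_P f g i x \<ge> iter_P f g (Suc i) x" by linarith
  qed
qed

end
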